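(* Let $\gamma\in(-2,0)$, $d_0>0$, and let $\underline{\epsilon}_0>0$ be a threshold for which statements (GE) and (AS) of the context hold. There exists $f_{\mathrm{in}}\ge0$ satisfying condition $\mathcal S(\epsilon)$ of the context for some $\epsilon\in[0,\underline{\epsilon}_0]$ such that, for the corresponding global solution $f$ of the Landau equation with asymptotic profile $f^\sharp_\infty$ given by (AS), the limiting function $f_\infty(t,x,v):=f^\sharp_\infty(x-tv,v)$ is neither the zero solution nor a traveling global Maxwellian.
   Context: Repeated lower case Latin indices are summed over $1,2,3$; $\alpha,\beta$ below $\partial$ symbols are multi-indices. The Landau equation for $f(t,x,v)\ge0$, $t\ge0$, $x,v\in\mathbb R^3$, is $$\partial_tf+v_i\partial_{x_i}f=\partial_{v_i}\int_{\mathbb R^3}a_{ij}(v-v_* )\big(f(v_* )(\partial_{v_j}f)(v)-f(v)(\partial_{v_j}f)(v_* )\big)\,dv_*,\qquad a_{ij}(z)=\Big(\delta_{ij}-\frac{z_iz_j}{|z|^2}\Big)|z|^{\gamma+2}.$$ $M_{\max}=2+2\lceil\frac{2}{2+\gamma}+4\rceil$ if $\gamma\in(-2,-1]$ and $M_{\max}=2+2\lceil\frac1{|\gamma|}+4\rceil$ if $\gamma\in(-1,0)$. Condition $\mathcal S(\epsilon)$ on $f_{\mathrm{in}}:\mathbb R^3\times\mathbb R^3\to[0,\infty)$: $$\sum_{|\alpha|+|\beta|\le M_{\max}}\big\|(1+|x|^2)^{\frac{M_{\max}+5}{2}}\partial_x^\alpha\partial_v^\beta(e^{2d_0(1+|v|^2)}f_{\mathrm{in}})\big\|_{L^2_xL^2_v}+\sum_{|\alpha|+|\beta|\le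 M_{\max}-5}\big\|(1+|x|^2)^{\frac{M_{\max}+5}{2}}(1+|v|^2)^{\frac12}\partial_x^\alpha\partial_v^\beta(e^{2d_0(1+|v|^2)}f_{\mathrm{in}})\big\|_{L^\infty_xL^\infty_v}\le\epsilon.$$ (GE): for every $\epsilon\in[0,\underline{\epsilon}_0]$ and every $f_{\mathrm{in}}$ satisfying $\mathcal S(\epsilon)$ there is a unique global solution $f$ on $[0,\infty)\times\mathbb R^3\times\mathbb R^3$ of the Landau equation with $f(0,\cdot,\cdot)=f_{\mathrm{in}}$ in $C^0([0,T];H^{4,0}_{\mathrm{ul}})\cap L^2([0,T];H^{4,1}_{\mathrm{ul}})$ for all $T>0$; it is $C^\infty$ for $t>0$. Here, with a smooth cutoff $0\le\phi\le1$ on $\mathbb R^3$, $\phi=1$ on $|x|\le1$, $\phi=0$ on $|x|\ge2$, $H^{k,\ell}_{\mathrm{ul}}$ is the completion of the Schwartz space under $\|h\|_{H^{k,\ell}_{\mathrm{ul}}}=\sum_{|\alpha|+|\beta|\le k}\big(\sup_{a\in\mathbb R^3}\iint|\phi(x-a)(1+|v|^2)^{\ell/2}\partial_x^\alpha\partial_v^\beta h|^2\,dv\,dx\big)^{1/2}$. (AS): for every such $f$, with $f^\sharp(t,x,v)=f(t,x+tv,v)$, there is a unique $f^\sharp_\infty:\mathbb R^3\times\mathbb R^3\to\mathbb R$ such that for every $\ell\in\mathbb N\cup\{0\}$, $\sup_{t\ge0}(1+t)^{\min\{1,2+\gamma\}}\|(1+|v|^2)^{\ell/2}(1+|x|^2)^{(M_{\max}+4)/2}(f^\sharp(t,x,v)-f^\sharp_\infty(x,v))\|_{L^\infty_xL^\infty_v}\le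 C_\ell\epsilon^{3/2}$, with $C_\ell$ depending only on $\gamma,d_0,\ell$. A traveling global Maxwellian is a function $\mathcal M$ on $[0,+\infty)\times\mathbb R^3\times\mathbb R^3$ of the form $$\mathcal M(t,x,v)=\frac{m\sqrt{\det Q}}{(2\pi)^3}\exp\left(-\frac12\begin{pmatrix} v \\ x-tv \end{pmatrix}^{T}\begin{pmatrix} \sigma I & \beta I+B \\ \beta I-B & \alpha I \end{pmatrix}\begin{pmatrix} v \\ x-tv \end{pmatrix}\right)$$ for some $m\ge0$, $\alpha,\sigma>0$, $\beta\in\mathbb R$ and a skew-symmetric $B\in\mathbb R^{3\times3}$ such that $Q=(\alpha\sigma-\beta^2)I+B^2$ is positive definite. *)

theory Defs
  imports "HOL-Probability.Probability"
begin

section \<open>Smooth functions and weak derivatives on phase space\<close>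

type_synonym phase = "(real^3) \<times> (real^3)"

definition pd :: "'a::euclidean_space \<Rightarrow> ('a \<Rightarrow> real) \<Rightarrow> 'a \<Rightarrow> real" where
  "pd b f = (\<lambda>z. frechet_derivative f (at z) b)"

primrec Ck_on :: "nat \<Rightarrow> 'a::euclidean_space set \<Rightarrow> ('a \<Rightarrow> real) \<Rightarrow> bool" where
  "Ck_on 0 S f \<longleftrightarrow> continuous_on S f"
| "Ck_on (Suc k) S f \<longleftrightarrow> f differentiable_on S \<and> (\<forall>b\<in>Basis. Ck_on k S (pd b f))"

text \<open>Only used for open \<open>S\<close>.\<close>

definition smooth_on :: "'a::euclidean_space set \<Rightarrow> ('a \<Rightarrow> real) \<Rightarrow> bool" where
  "smooth_on S f \<longleftrightarrow> (\<forall>k. Ck_on k S f)"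

definition test_fun :: "'a::euclidean_space set \<Rightarrow> ('a \<Rightarrow> real) \<Rightarrow> bool" where
  "test_fun S \<psi> \<longleftrightarrow> smooth_on UNIV \<psi> \<and> compact (closure {z. \<psi> z \<noteq> 0})
     \<and> closure {z. \<psi> z \<noteq> 0} \<subseteq> S"

definition ex :: "3 \<Rightarrow> phase" where "ex i = (axis i 1, 0)"
definition ev :: "3 \<Rightarrow> phase" where "ev i = (0, axis i 1)"

definition mi_abs :: "nat^3 \<Rightarrow> nat" where
  "mi_abs \<alpha> = (\<Sum>i\<in>UNIV. \<alpha> $ i)"

definition multi_pairs :: "nat \<Rightarrow> ((nat^3) \<times> (nat^3)) set" where
  "multi_pairs k = {(\<alpha>, \<beta>). mi_abs \<alpha> + mi_abs \<beta> \<le> k}"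

text \<open>The classical derivative \<open>\<partial>\<^sub>x\<^sup>\<alpha> \<partial>\<^sub>v\<^sup>\<beta>\<close>; it is only applied to smooth functions.\<close>

definition mdiff :: "nat^3 \<Rightarrow> nat^3 \<Rightarrow> (phase \<Rightarrow> real) \<Rightarrow> phase \<Rightarrow> real" where
  "mdiff \<alpha> \<beta> h =
     (pd (ex 1) ^^ (\<alpha> $ 1)) ((pd (ex 2) ^^ (\<alpha> $ 2)) ((pd (ex 3) ^^ (\<alpha> $ 3))
       ((pd (ev 1) ^^ (\<beta> $ 1)) ((pd (ev 2) ^^ (\<beta> $ 2)) ((pd (ev 3) ^^ (\<beta> $ 3)) h)))))"

definition loc_integrable :: "(phase \<Rightarrow> real) \<Rightarrow> bool" where
  "loc_integrable h \<longleftrightarrow> (\<forall>K. compact K \<longrightarrow> set_integrable lebesgue K h)"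

definition weak_deriv ::
  "nat^3 \<Rightarrow> nat^3 \<Rightarrow> (phase \<Rightarrow> real) \<Rightarrow> (phase \<Rightarrow> real) \<Rightarrow> bool" where
  "weak_deriv \<alpha> \<beta> h g \<longleftrightarrow> loc_integrable h \<and> loc_integrable g \<and>
     (\<forall>\<psi>. test_fun UNIV \<psi> \<longrightarrow>
        (\<integral>z. h z * mdiff \<alpha> \<beta> \<psi> z \<partial>lebesgue)
          = (-1) ^ (mi_abs \<alpha> + mi_abs \<beta>) * (\<integral>z. g z * \<psi> z \<partial>lebesgue))"

definition weak_jet ::
  "nat \<Rightarrow> (phase \<Rightarrow> real) \<Rightarrow> (nat^3 \<Rightarrow> nat^3 \<Rightarrow> phase \<Rightarrow> real) \<Rightarrow> bool" where
  "weak_jet k h G \<longleftrightarrow> (\<forall>(\<alpha>, \<beta>)\<in>multi_pairs k. weak_deriv \<alpha> \<beta> h (G \<alpha> \<beta>))"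

definition esqrt :: "ennreal \<Rightarrow> ennreal" where
  "esqrt r = (if r = \<infinity> then \<infinity> else ennreal (sqrt (enn2real r)))"

definition L2_norm :: "(phase \<Rightarrow> real) \<Rightarrow> ennreal" where
  "L2_norm h = esqrt (\<integral>\<^sup>+z. ennreal ((h z)\<^sup>2) \<partial>lebesgue)"

definition Linf_norm :: "(phase \<Rightarrow> real) \<Rightarrow> ennreal" where
  "Linf_norm h = esssup lebesgue (\<lambda>z. ennreal \<bar>h z\<bar>)"

section \<open>Uniformly local Sobolev spaces\<close>

definition cutoff :: "(real^3 \<Rightarrow> real) \<Rightarrow> bool" where
  "cutoff \<phi> \<longleftrightarrow> smooth_on UNIV \<phi> \<and> (\<forall>x. 0 \<le> \<phi> x \<and> \<phi> x \<le> 1)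
     \<and> (\<forall>x. norm x \<le> 1 \<longrightarrow> \<phi> x = 1) \<and> (\<forall>x. norm x \<ge> 2 \<longrightarrow> \<phi> x = 0)"

text \<open>Weak derivatives are unique up to null sets, so the infimum below is over at most one
  value; it is \<open>\<infinity>\<close> if some weak derivative of order at most \<open>k\<close> does not exist.\<close>

definition ul_norm :: "(real^3 \<Rightarrow> real) \<Rightarrow> nat \<Rightarrow> nat \<Rightarrow> (phase \<Rightarrow> real) \<Rightarrow> ennreal" where
  "ul_norm \<phi> k l h = (INF G\<in>{G. weak_jet k h G}.
     (\<Sum>(\<alpha>, \<beta>)\<in>multi_pairs k. esqrt (SUP a::real^3.
        (\<integral>\<^sup>+(x, v). ennreal ((\<phi> (x - a) * (1 + (norm v)\<^sup>2) powr (real l / 2) * G \<alpha> \<beta> (x, v))\<^sup>2)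
           \<partial>lebesgue))))"

definition schwartz :: "(phase \<Rightarrow> real) \<Rightarrow> bool" where
  "schwartz h \<longleftrightarrow> smooth_on UNIV h \<and>
     (\<forall>\<alpha> \<beta> N. bounded (range (\<lambda>z. (1 + norm z) ^ N * mdiff \<alpha> \<beta> h z)))"

text \<open>The space of functions with finite norm is complete modulo null sets, so the completion
  of the Schwartz space is realised as its closure there.\<close>

definition H_ul :: "(real^3 \<Rightarrow> real) \<Rightarrow> nat \<Rightarrow> nat \<Rightarrow> (phase \<Rightarrow> real) set" where
  "H_ul \<phi> k l = {h. \<exists>s. (\<forall>n. schwartz (s n)) \<and>
     (\<lambda>n. ul_norm \<phi> k l (\<lambda>z. s n z - h z)) \<longlonglongrightarrow> 0}"

definition C0_H_ul ::
  "(real^3 \<Rightarrow> real) \<Rightarrow> nat \<Rightarrow> nat \<Rightarrow> real \<Rightarrow> (real \<Rightarrow> phase \<Rightarrow> real) \<Rightarrow> bool" where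
  "C0_H_ul \<phi> k l T f \<longleftrightarrow> (\<forall>t\<in>{0..T}. f t \<in> H_ul \<phi> k l \<and>
     ((\<lambda>s. ul_norm \<phi> k l (\<lambda>z. f s z - f t z)) \<longlongrightarrow> 0) (at t within {0..T}))"

text \<open>Bochner square integrability; the \<open>s n\<close> are simple functions of time.\<close>

definition L2_H_ul ::
  "(real^3 \<Rightarrow> real) \<Rightarrow> nat \<Rightarrow> nat \<Rightarrow> real \<Rightarrow> (real \<Rightarrow> phase \<Rightarrow> real) \<Rightarrow> bool" where
  "L2_H_ul \<phi> k l T f \<longleftrightarrow>
     (\<exists>s :: nat \<Rightarrow> real \<Rightarrow> phase \<Rightarrow> real.
        (\<forall>n. finite (s n ` {0..T}) \<and> s n ` {0..T} \<subseteq> H_ul \<phi> k l \<and>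
           (\<forall>h. {t\<in>{0..T}. s n t = h} \<in> sets lebesgue)) \<and>
        (AE t in lebesgue. t \<in> {0..T} \<longrightarrow> (\<lambda>n. ul_norm \<phi> k l (\<lambda>z. s n t z - f t z)) \<longlonglongrightarrow> 0)) \<and>
     (\<integral>\<^sup>+t\<in>{0..T}. (ul_norm \<phi> k l (f t))\<^sup>2 \<partial>lebesgue) < \<infinity>"

section \<open>The Landau equation\<close>

definition a_kernel :: "real \<Rightarrow> 3 \<Rightarrow> 3 \<Rightarrow> real^3 \<Rightarrow> real" where
  "a_kernel \<gamma> i j z =
     ((if i = j then 1 else 0) - z $ i * z $ j / (norm z)\<^sup>2) * norm z powr (\<gamma> + 2)"

text \<open>Here \<open>g j\<close> stands for \<open>\<partial>\<^bsub>v\<^sub>j\<^esub> h\<close> and \<open>w\<close> for \<open>v\<^sub>*\<close>.\<close>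

definition flux_integrand ::
  "real \<Rightarrow> (phase \<Rightarrow> real) \<Rightarrow> (3 \<Rightarrow> phase \<Rightarrow> real) \<Rightarrow> 3 \<Rightarrow> phase \<Rightarrow> real^3 \<Rightarrow> real" where
  "flux_integrand \<gamma> h g i = (\<lambda>(x, v) w.
     \<Sum>j\<in>UNIV. a_kernel \<gamma> i j (v - w) * (h (x, w) * g j (x, v) - h (x, v) * g j (x, w)))"

definition flux ::
  "real \<Rightarrow> (phase \<Rightarrow> real) \<Rightarrow> (3 \<Rightarrow> phase \<Rightarrow> real) \<Rightarrow> 3 \<Rightarrow> phase \<Rightarrow> real" where
  "flux \<gamma> h g i z = (\<integral>w. flux_integrand \<gamma> h g i z w \<partial>lebesgue)"

text \<open>The equation on \<open>(0, \<infinity>) \<times> \<real>\<^sup>3 \<times> \<real>\<^sup>3\<close> in the sense of distributions: functions in the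
  energy space need not have classical derivatives. The collision integral is required to
  converge absolutely almost everywhere.\<close>

definition landau_equation :: "real \<Rightarrow> (real \<Rightarrow> phase \<Rightarrow> real) \<Rightarrow> bool" where
  "landau_equation \<gamma> f \<longleftrightarrow> (\<exists>g :: real \<Rightarrow> 3 \<Rightarrow> phase \<Rightarrow> real.
     (AE t in lebesgue. t > 0 \<longrightarrow> (\<forall>i.
        weak_deriv 0 (axis i 1) (f t) (g t i) \<and>
        (AE z in lebesgue. integrable lebesgue (flux_integrand \<gamma> (f t) (g t) i z)) \<and>
        loc_integrable (flux \<gamma> (f t) (g t) i))) \<and>
     (\<forall>\<psi> :: real \<times> phase \<Rightarrow> real. test_fun ({0<..} \<times> UNIV) \<psi> \<longrightarrow>
        (let A = (\<lambda>t. \<integral>(x, v). f t (x, v) *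
                     (pd (1, 0) \<psi> (t, x, v) + (\<Sum>i\<in>UNIV. v $ i * pd (0, ex i) \<psi> (t, x, v)))
                   \<partial>lebesgue);
             B = (\<lambda>t. \<integral>z. (\<Sum>i\<in>UNIV. flux \<gamma> (f t) (g t) i z * pd (0, ev i) \<psi> (t, z)) \<partial>lebesgue)
         in set_integrable lebesgue {0<..} A \<and> set_integrable lebesgue {0<..} B \<and>
            (LINT t:{0<..}|lebesgue. A t) = (LINT t:{0<..}|lebesgue. B t))))"

definition landau_solution ::
  "(real^3 \<Rightarrow> real) \<Rightarrow> real \<Rightarrow> (phase \<Rightarrow> real) \<Rightarrow> (real \<Rightarrow> phase \<Rightarrow> real) \<Rightarrow> bool" where
  "landau_solution \<phi> \<gamma> fin f \<longleftrightarrow>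
     (\<forall>t\<ge>0. AE z in lebesgue. 0 \<le> f t z) \<and>
     (AE z in lebesgue. f 0 z = fin z) \<and>
     (\<forall>T>0. C0_H_ul \<phi> 4 0 T f \<and> L2_H_ul \<phi> 4 1 T f) \<and>
     landau_equation \<gamma> f"

definition smooth_landau_solution ::
  "(real^3 \<Rightarrow> real) \<Rightarrow> real \<Rightarrow> (phase \<Rightarrow> real) \<Rightarrow> (real \<Rightarrow> phase \<Rightarrow> real) \<Rightarrow> bool" where
  "smooth_landau_solution \<phi> \<gamma> fin f \<longleftrightarrow>
     landau_solution \<phi> \<gamma> fin f \<and> smooth_on ({0<..} \<times> UNIV) (\<lambda>(t, z). f t z)"

section \<open>Smallness condition, global existence and asymptotic stability\<close>

definition M_max :: "real \<Rightarrow> nat" where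
  "M_max \<gamma> = (if \<gamma> \<le> -1 then 2 + 2 * nat \<lceil>2 / (2 + \<gamma>) + 4\<rceil>
              else 2 + 2 * nat \<lceil>1 / \<bar>\<gamma>\<bar> + 4\<rceil>)"

text \<open>The derivatives in the norms are weak derivatives; they form the family \<open>G\<close>.\<close>

definition small_data :: "real \<Rightarrow> real \<Rightarrow> real \<Rightarrow> (phase \<Rightarrow> real) \<Rightarrow> bool" where
  "small_data \<gamma> d0 \<epsilon> fin \<longleftrightarrow> (\<forall>z. 0 \<le> fin z) \<and>
     (\<exists>G. weak_jet (M_max \<gamma>) (\<lambda>(x, v). exp (2 * d0 * (1 + (norm v)\<^sup>2)) * fin (x, v)) G \<and>
        (\<Sum>(\<alpha>, \<beta>)\<in>multi_pairs (M_max \<gamma>).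
           L2_norm (\<lambda>(x, v). (1 + (norm x)\<^sup>2) powr ((real (M_max \<gamma>) + 5) / 2) * G \<alpha> \<beta> (x, v)))
        + (\<Sum>(\<alpha>, \<beta>)\<in>multi_pairs (M_max \<gamma> - 5).
           Linf_norm (\<lambda>(x, v). (1 + (norm x)\<^sup>2) powr ((real (M_max \<gamma>) + 5) / 2)
                               * (1 + (norm v)\<^sup>2) powr (1 / 2) * G \<alpha> \<beta> (x, v)))
        \<le> ennreal \<epsilon>)"

text \<open>Uniqueness is up to null sets, as for elements of the energy space.\<close>

definition global_existence :: "(real^3 \<Rightarrow> real) \<Rightarrow> real \<Rightarrow> real \<Rightarrow> real \<Rightarrow> bool" where
  "global_existence \<phi> \<gamma> d0 \<epsilon>0 \<longleftrightarrow>
     (\<forall>\<epsilon>\<in>{0..\<epsilon>0}. \<forall>fin. small_data \<gamma> d0 \<epsilon> fin \<longrightarrow>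
        (\<exists>f. smooth_landau_solution \<phi> \<gamma> fin f \<and>
           (\<forall>f'. landau_solution \<phi> \<gamma> fin f' \<longrightarrow> (\<forall>t\<ge>0. AE z in lebesgue. f' t z = f t z))))"

definition sharp :: "(real \<Rightarrow> phase \<Rightarrow> real) \<Rightarrow> real \<Rightarrow> phase \<Rightarrow> real" where
  "sharp f t = (\<lambda>(x, v). f t (x + t *\<^sub>R v, v))"

definition asymptotic_profile ::
  "real \<Rightarrow> (nat \<Rightarrow> real) \<Rightarrow> real \<Rightarrow> (real \<Rightarrow> phase \<Rightarrow> real) \<Rightarrow> (phase \<Rightarrow> real) \<Rightarrow> bool" where
  "asymptotic_profile \<gamma> C \<epsilon> f F \<longleftrightarrow> F \<in> borel_measurable lebesgue \<and>
     (\<forall>l. (SUP t\<in>{0..}. ennreal ((1 + t) powr (min 1 (2 + \<gamma>))) *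
             Linf_norm (\<lambda>(x, v). (1 + (norm v)\<^sup>2) powr (real l / 2)
                * (1 + (norm x)\<^sup>2) powr ((real (M_max \<gamma>) + 4) / 2)
                * (sharp f t (x, v) - F (x, v))))
          \<le> ennreal (C l * \<epsilon> powr (3 / 2)))"

text \<open>The constants \<open>C l\<close> are fixed before \<open>\<epsilon>\<close>, the initial datum and the solution. The profile
  is an element of a weighted \<open>L\<^sup>\<infinity>\<close> space, hence unique up to null sets.\<close>

definition asymptotic_stability ::
  "(real^3 \<Rightarrow> real) \<Rightarrow> real \<Rightarrow> real \<Rightarrow> real \<Rightarrow> (nat \<Rightarrow> real) \<Rightarrow> bool" where
  "asymptotic_stability \<phi> \<gamma> d0 \<epsilon>0 C \<longleftrightarrow>
     (\<forall>\<epsilon>\<in>{0..\<epsilon>0}. \<forall>fin f. small_data \<gamma> d0 \<epsilon> fin \<longrightarrow> smooth_landau_solution \<phi> \<gamma> fin f \<longrightarrow>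
        (\<exists>F. asymptotic_profile \<gamma> C \<epsilon> f F \<and>
           (\<forall>F'. asymptotic_profile \<gamma> C \<epsilon> f F' \<longrightarrow> (AE z in lebesgue. F' z = F z))))"

definition limit_solution :: "(phase \<Rightarrow> real) \<Rightarrow> real \<Rightarrow> phase \<Rightarrow> real" where
  "limit_solution F t = (\<lambda>(x, v). F (x - t *\<^sub>R v, v))"

section \<open>Traveling global Maxwellians\<close>

text \<open>The quadratic form of the block matrix is written out; \<open>mat c\<close> is \<open>c I\<close>.\<close>

definition traveling_maxwellian :: "(real \<Rightarrow> phase \<Rightarrow> real) \<Rightarrow> bool" where
  "traveling_maxwellian M \<longleftrightarrow>
     (\<exists>(m::real) (\<alpha>::real) (\<sigma>::real) (\<beta>::real) (B::real^3^3).
        m \<ge> 0 \<and> \<alpha> > 0 \<and> \<sigma> > 0 \<and> transpose B = - B \<and>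
        (let Q = mat (\<alpha> * \<sigma> - \<beta>\<^sup>2) + B ** B in
          (\<forall>y. y \<noteq> 0 \<longrightarrow> y \<bullet> (Q *v y) > 0) \<and>
          (\<forall>t\<ge>0. \<forall>x v. M t (x, v) =
             m * sqrt (det Q) / (2 * pi) ^ 3 *
             exp (- (1 / 2) * (let w = x - t *\<^sub>R v in
               v \<bullet> (mat \<sigma> *v v + (mat \<beta> + B) *v w) +
               w \<bullet> ((mat \<beta> - B) *v v + mat \<alpha> *v w))))))"

definition ae_eq_spacetime ::
  "(real \<Rightarrow> phase \<Rightarrow> real) \<Rightarrow> (real \<Rightarrow> phase \<Rightarrow> real) \<Rightarrow> bool" where
  "ae_eq_spacetime f g \<longleftrightarrow> (AE (t, z) in lebesgue. t \<ge> 0 \<longrightarrow> f t z = g t z)"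

end

theory Submission
  imports Defs
begin

text \<open>
  The decay estimate of the asymptotic stability statement holds for all times, in particular for
  \<open>t = 0\<close>, where it says that the profile differs from the initial datum by at most
  \<open>|C 0| \<epsilon> powr (3 / 2)\<close>. The datum itself can be taken of size proportional to \<open>\<epsilon>\<close>. So for small
  \<open>\<epsilon>\<close> the profile has essentially the shape of the initial datum, and this shape is ours to choose:
  it only has to stay at a distance from zero and from all Maxwellian shapes that scales linearly
  with the amplitude.

  A single comparison of two points separates a shape from all these candidates. Restricted to
  \<open>v = 0\<close>, the profile of a traveling Maxwellian is a centred Gaussian in \<open>x\<close>, so its value at
  \<open>e = (e\<^sub>1, 0)\<close> is at most its value at the origin (\<open>traveling_maxwellian_profile\<close>); the
  same is true of the zero function. The datum is therefore a bump around \<open>e\<close> that vanishes at the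
  origin. If its profile were one of the candidates, the datum at \<open>e\<close> would be at most
  \<open>2 |C 0| \<epsilon> powr (3 / 2)\<close> (\<open>initial_datum_le_if_profile_peaks_at_origin\<close>), whereas it is a
  fixed positive multiple of \<open>\<epsilon>\<close>; this fails for small \<open>\<epsilon>\<close>.

  The remaining work is to show that the bump satisfies the smallness condition
  (\<open>small_data_scaled\<close>). The condition involves weak derivatives up to the order \<open>M_max \<gamma>\<close>
  only, so a compactly supported bump of class \<open>C\<^sup>k\<close> with \<open>k = M_max \<gamma>\<close> suffices, and a power
  of the positive part of a polynomial provides one (\<open>exists_Ck_bump\<close>). Its classical derivatives
  are weak derivatives by integration by parts (\<open>weak_deriv_if_Ck_on\<close>).
\<close>

section \<open>Integration by parts for compactly supported functions\<close>

lemma pd_eq: "(f has_derivative f') (at z) \<Longrightarrow> pd b f z = f' b"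
  unfolding pd_def using frechet_derivative_at by metis

lemma pd_zero_outside:
  fixes F :: "'a::euclidean_space \<Rightarrow> real"
  assumes "\<And>z. z \<notin> cball 0 R \<Longrightarrow> F z = 0" and "z \<notin> cball 0 R"
  shows "pd b F z = 0"
proof -
  have "((\<lambda>_. 0 :: real) has_derivative (\<lambda>_. 0)) (at z)"
    by simp
  then have "(F has_derivative (\<lambda>_. 0)) (at z)"
    by (rule has_derivative_transform_within_open[where s = "- cball 0 R"])
      (use assms in \<open>auto simp: open_Compl\<close>)
  then show ?thesis
    by (simp add: pd_eq)
qed

lemma bounded_if_continuous_zero_outside:
  fixes F :: "'a::euclidean_space \<Rightarrow> real"
  assumes "continuous_on UNIV F" and "\<And>z. z \<notin> cball 0 R \<Longrightarrow> F z = 0"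
  obtains K where "K \<ge> 0" and "\<And>z. \<bar>F z\<bar> \<le> K"
proof -
  have "compact (F ` cball 0 R)"
    using assms(1) by (intro compact_continuous_image) (auto intro: continuous_on_subset)
  then have "bounded (F ` cball 0 R)"
    by (rule compact_imp_bounded)
  then obtain K where K: "K > 0" "\<And>y. y \<in> F ` cball 0 R \<Longrightarrow> norm y \<le> K"
    unfolding bounded_pos by auto
  have "\<bar>F z\<bar> \<le> K" for z
  proof (cases "z \<in> cball 0 R")
    case True
    then show ?thesis
      using K(2)[of "F z"] by simp
  next
    case False
    then show ?thesis
      using K(1) assms(2) by simp
  qed
  then show ?thesis
    using K(1) that[of K] by simp
qed

lemma integrable_lborel_if_continuous_zero_outside:
  fixes F :: "'a::euclidean_space \<Rightarrow> real"
  assumes "continuous_on UNIV F" and "\<And>z. z \<notin> cball 0 R \<Longrightarrow> F z = 0"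
  shows "integrable lborel F"
proof -
  have "integrable lborel (\<lambda>z. indicator (cball 0 R) z *\<^sub>R F z)"
    using assms(1) by (intro borel_integrable_compact) (auto intro: continuous_on_subset)
  also have "(\<lambda>z. indicator (cball 0 R) z *\<^sub>R F z) = F"
    using assms(2) by (auto simp: fun_eq_iff indicator_def)
  finally show ?thesis .
qed

lemma integral_lborel_translate:
  fixes F :: "'a::euclidean_space \<Rightarrow> real"
  assumes "F \<in> borel_measurable borel"
  shows "(\<integral>z. F (a + z) \<partial>lborel) = (\<integral>z. F z \<partial>lborel)"
proof -
  have "(\<integral>z. F z \<partial>lborel) = (\<integral>z. F z \<partial>distr lborel borel ((+) a))"
    by (simp add: lborel_distr_plus)
  also have "\<dots> = (\<integral>z. F (a + z) \<partial>lborel)"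
    using assms by (subst integral_distr) auto
  finally show ?thesis ..
qed

text \<open>Translating the argument by \<open>s b\<close> does not change the integral of \<open>F\<close>, so every difference
  quotient in direction \<open>b\<close> has integral zero. On the compact support of \<open>F\<close> the quotients are
  bounded by the mean value theorem, and dominated convergence lets \<open>s\<close> tend to zero. Arguing by
  translation avoids a Fubini decomposition along \<open>b\<close>.\<close>

lemma integral_pd_eq_0:
  fixes F :: "'a::euclidean_space \<Rightarrow> real"
  assumes diff: "\<And>z. F differentiable (at z)" and cont: "continuous_on UNIV (pd b F)"
    and supp: "\<And>z. z \<notin> cball 0 R \<Longrightarrow> F z = 0"
  shows "(\<integral>z. pd b F z \<partial>lborel) = 0"
proof -
  have contF: "continuous_on UNIV F"
    using diff by (simp add: continuous_on_eq_continuous_at differentiable_imp_continuous_within)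
  have pd0: "pd b F z = 0" if "z \<notin> cball 0 R" for z
    using supp that by (rule pd_zero_outside)
  obtain K where K: "K \<ge> 0" "\<And>z. \<bar>pd b F z\<bar> \<le> K"
    using bounded_if_continuous_zero_outside[OF cont pd0] by blast
  define s where "s n = inverse (real (Suc n))" for n
  define D where "D n z = (F (s n *\<^sub>R b + z) - F z) / s n" for n z
  have s: "0 < s n" "s n \<le> 1" for n
    by (simp_all add: s_def inverse_eq_divide)
  \<comment> \<open>Along a line in direction \<open>b\<close> the directional derivative is an ordinary derivative.\<close>
  have line: "((\<lambda>r. F (r *\<^sub>R b + z)) has_real_derivative pd b F (r *\<^sub>R b + z)) (at r)" for r z
  proof -
    have "(F has_derivative frechet_derivative F (at (r *\<^sub>R b + z))) (at (r *\<^sub>R b + z))"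
      using diff frechet_derivative_works by blast
    moreover have "((\<lambda>r. r *\<^sub>R b + z) has_derivative (\<lambda>h. h *\<^sub>R b)) (at r)"
      by (auto intro!: derivative_eq_intros)
    ultimately have "((\<lambda>r. F (r *\<^sub>R b + z)) has_derivative
        (\<lambda>h. frechet_derivative F (at (r *\<^sub>R b + z)) (h *\<^sub>R b))) (at r)"
      by (rule has_derivative_compose[rotated])
    moreover have "frechet_derivative F (at (r *\<^sub>R b + z)) (h *\<^sub>R b) = pd b F (r *\<^sub>R b + z) * h" for h
      using linear_frechet_derivative[OF diff] by (simp add: pd_def linear_cmul)
    ultimately show ?thesis
      by (simp add: has_field_derivative_def)
  qed
  \<comment> \<open>Since \<open>s n \<le> 1\<close>, a translate of the support stays in the ball enlarged by \<open>norm b\<close>.\<close>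
  have bound: "norm (D n z) \<le> indicator (cball 0 (R + norm b)) z * K" for n z
  proof (cases "z \<in> cball 0 (R + norm b)")
    case True
    obtain r where r: "F (s n *\<^sub>R b + z) - F (0 *\<^sub>R b + z) = (s n - 0) * pd b F (r *\<^sub>R b + z)"
      using MVT2[OF s(1)[of n] line] by blast
    then have "D n z = pd b F (r *\<^sub>R b + z)"
      using s(1)[of n] by (simp add: D_def)
    then show ?thesis
      using True K by simp
  next
    case False
    have "norm (s n *\<^sub>R b) \<le> norm b"
      using s[of n] by (simp add: mult_left_le_one_le)
    then have "norm (s n *\<^sub>R b + z) > R"
      using False norm_triangle_ineq4[of "s n *\<^sub>R b + z" "s n *\<^sub>R b"] by auto
    then have "F (s n *\<^sub>R b + z) = 0" "F z = 0"
      using False norm_ge_zero[of b] by (auto intro!: supp simp del: norm_ge_zero)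
    then show ?thesis
      using K by (simp add: D_def)
  qed
  have lim: "(\<lambda>n. D n z) \<longlonglongrightarrow> pd b F z" for z
  proof -
    have "((\<lambda>h. (F ((0 + h) *\<^sub>R b + z) - F (0 *\<^sub>R b + z)) / h) \<longlongrightarrow> pd b F (0 *\<^sub>R b + z)) (at 0)"
      using line[of z 0] by (rule DERIV_D)
    moreover have "filterlim s (at 0) sequentially"
      unfolding filterlim_at
      using LIMSEQ_inverse_real_of_nat s(1) by (auto simp: s_def[abs_def])
    ultimately have "((\<lambda>n. (F ((0 + s n) *\<^sub>R b + z) - F (0 *\<^sub>R b + z)) / s n) \<longlongrightarrow> pd b F (0 *\<^sub>R b + z))
        sequentially"
      by (rule filterlim_compose)
    then show ?thesis
      by (simp add: D_def)
  qed
  have intF: "integrable lborel F"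
    by (rule integrable_lborel_if_continuous_zero_outside[OF contF supp])
  have intFs: "integrable lborel (\<lambda>z. F (a + z))" for a
  proof (rule integrable_lborel_if_continuous_zero_outside[where R = "R + norm a"])
    show "continuous_on UNIV (\<lambda>z. F (a + z))"
      by (intro continuous_intros continuous_on_compose2[OF contF]) auto
    show "F (a + z) = 0" if "z \<notin> cball 0 (R + norm a)" for z
      using that norm_triangle_ineq4[of "a + z" a] by (intro supp) auto
  qed
  have "(\<integral>z. D n z \<partial>lborel) = 0" for n
    using intF intFs contF
    by (simp add: D_def integral_lborel_translate borel_measurable_continuous_onI)
  moreover have "(\<lambda>n. \<integral>z. D n z \<partial>lborel) \<longlonglongrightarrow> (\<integral>z. pd b F z \<partial>lborel)"
  proof (rule integral_dominated_convergence)
    show "pd b F \<in> borel_measurable lborel"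
      using cont by (simp add: borel_measurable_continuous_onI)
    show "D n \<in> borel_measurable lborel" for n
      unfolding D_def[abs_def]
      by (intro borel_measurable_divide borel_measurable_diff borel_measurable_const
          borel_measurable_integrable intF intFs)
    show "integrable lborel (\<lambda>z. indicator (cball 0 (R + norm b)) z * K)"
      using emeasure_bounded_finite[OF bounded_cball]
      by (intro integrable_mult_left integrable_real_indicator) (simp_all add: less_top)
    show "AE z in lborel. (\<lambda>n. D n z) \<longlonglongrightarrow> pd b F z"
      by (intro AE_I2 lim)
    show "AE z in lborel. norm (D n z) \<le> indicator (cball 0 (R + norm b)) z * K" for n
      by (intro AE_I2 bound)
  qed
  ultimately show ?thesis
    by (simp add: LIMSEQ_const_iff)
qed

lemma pd_mult:
  fixes f g :: "'a::euclidean_space \<Rightarrow> real"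
  assumes "f differentiable (at z)" and "g differentiable (at z)"
  shows "pd b (\<lambda>z. f z * g z) z = f z * pd b g z + pd b f z * g z"
proof -
  have "((\<lambda>z. f z * g z) has_derivative
      (\<lambda>y. f z * frechet_derivative g (at z) y + frechet_derivative f (at z) y * g z)) (at z)"
    using assms by (intro has_derivative_mult) (simp_all flip: frechet_derivative_works)
  then show ?thesis
    by (simp add: pd_eq) (simp add: pd_def)
qed

lemma Ck_on_Suc_imp_differentiable: "Ck_on (Suc k) UNIV f \<Longrightarrow> f differentiable (at z)"
  by (simp add: differentiable_on_def)

lemma Ck_on_imp_continuous_on: "Ck_on k UNIV f \<Longrightarrow> continuous_on UNIV f"
  by (cases k) (auto intro: differentiable_imp_continuous_on)

lemma Ck_on_pd: "Ck_on (Suc k) UNIV f \<Longrightarrow> b \<in> Basis \<Longrightarrow> Ck_on k UNIV (pd b f)"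
  by simp

lemma integral_by_parts_pd:
  fixes f g :: "'a::euclidean_space \<Rightarrow> real"
  assumes f: "Ck_on (Suc k) UNIV f" and g: "Ck_on (Suc l) UNIV g" and b: "b \<in> Basis"
    and supp: "\<And>z. z \<notin> cball 0 R \<Longrightarrow> f z = 0"
  shows "(\<integral>z. f z * pd b g z \<partial>lborel) = - (\<integral>z. pd b f z * g z \<partial>lborel)"
proof -
  note df = Ck_on_Suc_imp_differentiable[OF f] and dg = Ck_on_Suc_imp_differentiable[OF g]
  note cf = Ck_on_imp_continuous_on[OF f] and cg = Ck_on_imp_continuous_on[OF g]
  note cpf = Ck_on_imp_continuous_on[OF Ck_on_pd[OF f b]]
    and cpg = Ck_on_imp_continuous_on[OF Ck_on_pd[OF g b]]
  have "(\<integral>z. pd b (\<lambda>z. f z * g z) z \<partial>lborel) = 0"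
  proof (rule integral_pd_eq_0)
    show "(\<lambda>z. f z * g z) differentiable (at z)" for z
      using df dg by simp
    show "continuous_on UNIV (pd b (\<lambda>z. f z * g z))"
      unfolding pd_mult[OF df dg]
      using cf cg cpf cpg by (intro continuous_on_add continuous_on_mult)
    show "f z * g z = 0" if "z \<notin> cball 0 R" for z
      using supp[OF that] by simp
  qed
  then have "(\<integral>z. f z * pd b g z + pd b f z * g z \<partial>lborel) = 0"
    by (simp add: pd_mult[OF df dg])
  moreover have "integrable lborel (\<lambda>z. f z * pd b g z)"
  proof (rule integrable_lborel_if_continuous_zero_outside)
    show "f z * pd b g z = 0" if "z \<notin> cball 0 R" for z
      using supp[OF that] by simp
  qed (intro continuous_on_mult cf cpg)
  moreover have "integrable lborel (\<lambda>z. pd b f z * g z)"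
  proof (rule integrable_lborel_if_continuous_zero_outside)
    show "pd b f z * g z = 0" if "z \<notin> cball 0 R" for z
      using pd_zero_outside[of R f, OF supp that] by simp
  qed (intro continuous_on_mult cpf cg)
  ultimately show ?thesis
    by simp
qed

lemma Ck_on_foldr_pd:
  "Ck_on (length L + k) UNIV f \<Longrightarrow> set L \<subseteq> Basis \<Longrightarrow> Ck_on k UNIV (foldr pd L f)"
proof (induction L arbitrary: k)
  case (Cons b L)
  then have "Ck_on (Suc k) UNIV (foldr pd L f)"
    by (simp del: Ck_on.simps)
  then show ?case
    using Cons.prems by (auto intro: Ck_on_pd simp del: Ck_on.simps)
qed simp

lemma foldl_pd:
  assumes "Ck_on (length L + k) UNIV f" and "set L \<subseteq> Basis"
    and "\<And>z. z \<notin> cball 0 R \<Longrightarrow> f z = 0"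
  shows Ck_on_foldl_pd: "Ck_on k UNIV (foldl (\<lambda>g b. pd b g) f L)"
    and foldl_pd_zero_outside: "\<And>z. z \<notin> cball 0 R \<Longrightarrow> foldl (\<lambda>g b. pd b g) f L z = 0"
proof -
  have "Ck_on k UNIV (foldl (\<lambda>g b. pd b g) f L) \<and>
      (\<forall>z. z \<notin> cball 0 R \<longrightarrow> foldl (\<lambda>g b. pd b g) f L z = 0)"
    using assms
  proof (induction L arbitrary: f)
    case (Cons b L)
    show ?case
      unfolding foldl_Cons
    proof (rule Cons.IH)
      show "Ck_on (length L + k) UNIV (pd b f)"
        using Cons.prems by simp
      show "pd b f z = 0" if "z \<notin> cball 0 R" for z
        using pd_zero_outside Cons.prems(3) that by blast
    qed (use Cons.prems in auto)
  qed (auto simp del: Ck_on.simps)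
  then show "Ck_on k UNIV (foldl (\<lambda>g b. pd b g) f L)"
    and "\<And>z. z \<notin> cball 0 R \<Longrightarrow> foldl (\<lambda>g b. pd b g) f L z = 0"
    by blast+
qed

text \<open>Integration by parts removes the outermost derivative of \<open>g\<close> first. The derivatives therefore
  reach \<open>f\<close> in the opposite order, as a \<open>foldl\<close>; partial derivatives are never interchanged.\<close>

lemma integral_by_parts_foldr_pd:
  fixes f g :: "'a::euclidean_space \<Rightarrow> real"
  assumes "Ck_on (length L) UNIV f" and "smooth_on UNIV g" and "set L \<subseteq> Basis"
    and "\<And>z. z \<notin> cball 0 R \<Longrightarrow> f z = 0"
  shows "(\<integral>z. f z * foldr pd L g z \<partial>lborel)
    = (-1) ^ length L * (\<integral>z. foldl (\<lambda>g b. pd b g) f L z * g z \<partial>lborel)"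
  using assms
proof (induction L arbitrary: f)
  case (Cons b L)
  have "Ck_on (Suc 0) UNIV (foldr pd L g)"
    using Cons.prems by (intro Ck_on_foldr_pd) (auto simp: smooth_on_def)
  then have "(\<integral>z. f z * pd b (foldr pd L g) z \<partial>lborel) = - (\<integral>z. pd b f z * foldr pd L g z \<partial>lborel)"
    using Cons.prems by (intro integral_by_parts_pd[where R = R and k = "length L"]) 
       (auto simp del: Ck_on.simps)
  also have "(\<integral>z. pd b f z * foldr pd L g z \<partial>lborel)
      = (-1) ^ length L * (\<integral>z. foldl (\<lambda>g b. pd b g) (pd b f) L z * g z \<partial>lborel)"
  proof (rule Cons.IH)
    show "pd b f z = 0" if "z \<notin> cball 0 R" for z
      using pd_zero_outside Cons.prems(4) that by blast
  qed (use Cons.prems in auto)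
  finally show ?case
    by simp
qed simp

lemma Ck_on_mono: "Ck_on k UNIV f \<Longrightarrow> l \<le> k \<Longrightarrow> Ck_on l UNIV f"
proof (induction k arbitrary: f l)
  case (Suc k)
  show ?case
  proof (cases l)
    case 0
    then show ?thesis
      using Ck_on_imp_continuous_on[OF Suc.prems(1)] by simp
  next
    case (Suc l')
    then show ?thesis
      using Suc.prems Suc.IH[of _ l'] by auto
  qed
qed simp

section \<open>Weak derivatives of compactly supported functions\<close>

definition derivative_directions :: "nat^3 \<Rightarrow> nat^3 \<Rightarrow> phase list" where
  "derivative_directions \<alpha> \<beta> = replicate (\<alpha> $ 1) (ex 1) @ replicate (\<alpha> $ 2) (ex 2) @ replicate (\<alpha> $ 3) (ex 3)
     @ replicate (\<beta> $ 1) (ev 1) @ replicate (\<beta> $ 2) (ev 2) @ replicate (\<beta> $ 3) (ev 3)"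

lemma mdiff_eq_foldr_pd: "mdiff \<alpha> \<beta> h = foldr pd (derivative_directions \<alpha> \<beta>) h"
  by (simp add: mdiff_def derivative_directions_def)

lemma length_derivative_directions: "length (derivative_directions \<alpha> \<beta>) = mi_abs \<alpha> + mi_abs \<beta>"
  by (simp add: derivative_directions_def mi_abs_def sum_3)

lemma set_derivative_directions_subset: "set (derivative_directions \<alpha> \<beta>) \<subseteq> Basis"
  by (auto simp: derivative_directions_def ex_def ev_def Basis_prod_def axis_in_Basis_iff)

lemma loc_integrable_if_continuous: "continuous_on UNIV h \<Longrightarrow> loc_integrable h"
  unfolding loc_integrable_def set_integrable_def
proof (intro allI impI)
  fix K :: "phase set"
  assume h: "continuous_on UNIV h" and K: "compact K"
  have "integrable lborel (\<lambda>z. indicator K z *\<^sub>R h z)"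
    using K h by (intro borel_integrable_compact) (auto intro: continuous_on_subset)
  then show "integrable lebesgue (\<lambda>z. indicator K z *\<^sub>R h z)"
    using integrable_completion borel_measurable_integrable by blast
qed

text \<open>The compact support of \<open>h\<close> makes all boundary terms of the integration by parts vanish.\<close>

lemma weak_deriv_if_Ck_on:
  assumes h: "Ck_on (mi_abs \<alpha> + mi_abs \<beta>) UNIV h" and supp: "\<And>z. z \<notin> cball 0 R \<Longrightarrow> h z = 0"
  shows "weak_deriv \<alpha> \<beta> h (foldl (\<lambda>g b. pd b g) h (derivative_directions \<alpha> \<beta>))" (is "weak_deriv _ _ _ ?g")
  unfolding weak_deriv_def
proof (intro conjI allI impI)
  have ch: "continuous_on UNIV h"
    using h by (rule Ck_on_imp_continuous_on)
  have "Ck_on 0 UNIV ?g"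
    using h supp by (intro Ck_on_foldl_pd set_derivative_directions_subset)
      (simp_all add: length_derivative_directions)
  then have cg: "continuous_on UNIV ?g"
    by simp
  show "loc_integrable h" "loc_integrable ?g"
    using ch cg by (auto intro: loc_integrable_if_continuous)
  fix \<psi> :: "phase \<Rightarrow> real"
  assume "test_fun UNIV \<psi>"
  then have \<psi>: "smooth_on UNIV \<psi>"
    by (simp add: test_fun_def)
  then have c\<psi>: "continuous_on UNIV \<psi>"
    unfolding smooth_on_def using Ck_on.simps(1) by blast
  have "Ck_on 0 UNIV (foldr pd (derivative_directions \<alpha> \<beta>) \<psi>)"
    using \<psi> unfolding smooth_on_def by (intro Ck_on_foldr_pd set_derivative_directions_subset) blast
  then have cd\<psi>: "continuous_on UNIV (mdiff \<alpha> \<beta> \<psi>)"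
    by (simp add: mdiff_eq_foldr_pd)
  have "(\<integral>z. h z * foldr pd (derivative_directions \<alpha> \<beta>) \<psi> z \<partial>lborel)
      = (-1) ^ length (derivative_directions \<alpha> \<beta>) * (\<integral>z. ?g z * \<psi> z \<partial>lborel)"
    using h \<psi> supp by (intro integral_by_parts_foldr_pd set_derivative_directions_subset)
      (simp_all add: length_derivative_directions)
  moreover have "(\<integral>z. h z * mdiff \<alpha> \<beta> \<psi> z \<partial>lebesgue) = (\<integral>z. h z * mdiff \<alpha> \<beta> \<psi> z \<partial>lborel)"
    using ch cd\<psi> by (intro integral_completion) 
      (auto intro!: borel_measurable_continuous_onI continuous_on_mult)
  moreover have "(\<integral>z. ?g z * \<psi> z \<partial>lebesgue) = (\<integral>z. ?g z * \<psi> z \<partial>lborel)"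
    using cg c\<psi> by (intro integral_completion) 
      (auto intro!: borel_measurable_continuous_onI continuous_on_mult)
  ultimately show "(\<integral>z. h z * mdiff \<alpha> \<beta> \<psi> z \<partial>lebesgue)
      = (-1) ^ (mi_abs \<alpha> + mi_abs \<beta>) * (\<integral>z. ?g z * \<psi> z \<partial>lebesgue)"
    by (simp add: mdiff_eq_foldr_pd length_derivative_directions)
qed

lemma loc_integrable_cmult: "loc_integrable h \<Longrightarrow> loc_integrable (\<lambda>z. c * h z)"
  by (simp add: loc_integrable_def)

lemma weak_deriv_cmult:
  assumes "weak_deriv \<alpha> \<beta> h g"
  shows "weak_deriv \<alpha> \<beta> (\<lambda>z. c * h z) (\<lambda>z. c * g z)"
  using assms by (auto simp: weak_deriv_def loc_integrable_cmult mult.assoc)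

section \<open>Smallness of scaled data\<close>

lemma finite_multi_pairs: "finite (multi_pairs k)"
proof -
  define S where "S = vec_lambda ` (PiE (UNIV :: 3 set) (\<lambda>_. {..k}))"
  have "\<alpha> \<in> S" if "mi_abs \<alpha> \<le> k" for \<alpha> :: "nat^3"
  proof -
    have "\<alpha> $ i \<le> k" for i
      using member_le_sum[of i UNIV "\<lambda>i. \<alpha> $ i"] that by (simp add: mi_abs_def)
    then have "vec_nth \<alpha> \<in> PiE UNIV (\<lambda>_. {..k})"
      by auto
    then show ?thesis
      unfolding S_def by (rule rev_image_eqI) simp
  qed
  then have "multi_pairs k \<subseteq> S \<times> S"
    by (auto simp: multi_pairs_def)
  moreover have "finite S"
    unfolding S_def by (intro finite_imageI finite_PiE) auto
  ultimately show ?thesis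
    using finite_subset by blast
qed

lemma multi_pairs_mono: "k \<le> l \<Longrightarrow> multi_pairs k \<subseteq> multi_pairs l"
  by (auto simp: multi_pairs_def)

lemma esqrt_le:
  assumes "r \<le> ennreal s" and "s \<ge> 0"
  shows "esqrt r \<le> ennreal (sqrt s)"
proof -
  have "r \<noteq> \<infinity>"
    using assms(1) by (auto simp: top_unique)
  moreover have "enn2real r \<le> s"
    using assms by (intro enn2real_leI)
  ultimately show ?thesis
    by (simp add: esqrt_def ennreal_leI)
qed

lemma L2_norm_le:
  assumes "\<And>z. \<bar>f z\<bar> \<le> K" and "\<And>z. z \<notin> cball 0 R \<Longrightarrow> f z = 0"
  shows "L2_norm f \<le> ennreal (K * sqrt (measure lborel (cball (0 :: phase) R)))"
proof -
  let ?V = "measure lborel (cball (0 :: phase) R)"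
  have K: "K \<ge> 0"
    using assms(1)[of 0] by linarith
  have "(\<integral>\<^sup>+z. ennreal ((f z)\<^sup>2) \<partial>lebesgue)
      \<le> (\<integral>\<^sup>+z. ennreal (K\<^sup>2) * indicator (cball (0 :: phase) R) z \<partial>lebesgue)"
  proof (rule nn_integral_mono)
    fix z
    have "(f z)\<^sup>2 \<le> K\<^sup>2"
      using assms(1)[of z] by (simp add: abs_le_square_iff[symmetric] K)
    then show "ennreal ((f z)\<^sup>2) \<le> ennreal (K\<^sup>2) * indicator (cball 0 R) z"
      using assms(2)[of z] by (cases "z \<in> cball 0 R") (simp_all add: ennreal_leI)
  qed
  also have "\<dots> = ennreal (K\<^sup>2) * emeasure lborel (cball (0 :: phase) R)"
    by (simp add: nn_integral_cmult_indicator)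
  also have "emeasure lborel (cball (0 :: phase) R) = ennreal ?V"
    using emeasure_bounded_finite[OF bounded_cball] by (intro emeasure_eq_ennreal_measure)
      (rule less_imp_neq, simp)
  also have "ennreal (K\<^sup>2) * ennreal ?V = ennreal (K\<^sup>2 * ?V)"
    by (simp add: ennreal_mult)
  finally have "L2_norm f \<le> ennreal (sqrt (K\<^sup>2 * ?V))"
    unfolding L2_norm_def by (rule esqrt_le) simp
  then show ?thesis
    using K by (simp add: real_sqrt_mult)
qed

text \<open>One constant serves all scalings: the norms of the data shrink at least linearly with their
  amplitude, which is what the comparison with \<open>\<epsilon> powr (3 / 2)\<close> needs.\<close>

lemma norms_cmult_le:
  fixes f :: "phase \<Rightarrow> real"
  assumes cont: "continuous_on UNIV f" and supp: "\<And>z. z \<notin> cball 0 R \<Longrightarrow> f z = 0"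
  shows "\<exists>K\<ge>0. \<forall>c\<ge>0. L2_norm (\<lambda>z. c * f z) \<le> ennreal (c * K) \<and>
    Linf_norm (\<lambda>z. c * f z) \<le> ennreal (c * K)"
proof -
  obtain B where B: "B \<ge> 0" "\<And>z. \<bar>f z\<bar> \<le> B"
    using bounded_if_continuous_zero_outside[OF cont supp] by blast
  define V where "V = sqrt (measure lborel (cball (0 :: phase) R))"
  have V: "V \<ge> 0"
    by (simp add: V_def)
  show ?thesis
  proof (intro exI[of _ "B * (1 + V)"] conjI allI impI)
    fix c :: real
    assume c: "c \<ge> 0"
    have bound: "\<bar>c * f z\<bar> \<le> c * B" for z
      using B c by (simp add: abs_mult mult_left_mono)
    have "L2_norm (\<lambda>z. c * f z) \<le> ennreal (c * B * V)"
      unfolding V_def using bound supp by (intro L2_norm_le) auto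
    also have "\<dots> \<le> ennreal (c * (B * (1 + V)))"
      using B c V by (intro ennreal_leI) (simp add: algebra_simps)
    finally show "L2_norm (\<lambda>z. c * f z) \<le> ennreal (c * (B * (1 + V)))" .
    have "(\<lambda>z. c * f z) \<in> borel_measurable borel"
      using cont by (intro borel_measurable_continuous_onI continuous_intros)
    then have "(\<lambda>z. ennreal \<bar>c * f z\<bar>) \<in> borel_measurable borel"
      by measurable
    then have "(\<lambda>z. ennreal \<bar>c * f z\<bar>) \<in> borel_measurable lebesgue"
      by (intro measurable_completion) simp
    then have "Linf_norm (\<lambda>z. c * f z) \<le> ennreal (c * B)"
      unfolding Linf_norm_def using bound by (intro esssup_I AE_I2 ennreal_leI)
    also have "\<dots> \<le> ennreal (c * (B * (1 + V)))"
      using B c V by (intro ennreal_leI) (simp add: algebra_simps)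
    finally show "Linf_norm (\<lambda>z. c * f z) \<le> ennreal (c * (B * (1 + V)))" .
  qed (use B V in simp)
qed

lemma sum_le_ennreal_sum:
  assumes "\<And>p. p \<in> A \<Longrightarrow> f p \<le> ennreal (c * K p)" and "\<And>p. p \<in> A \<Longrightarrow> 0 \<le> K p" and "c \<ge> 0"
  shows "sum f A \<le> ennreal (c * sum K A)"
proof -
  have "sum f A \<le> (\<Sum>p\<in>A. ennreal (c * K p))"
    using assms(1) by (rule sum_mono)
  also have "\<dots> = ennreal (c * sum K A)"
    using assms(2,3) by (simp add: sum_distrib_left sum_ennreal)
  finally show ?thesis .
qed

text \<open>The factor \<open>exp (- 2 d0 (1 + |v|\<^sup>2))\<close> cancels the exponential weight in the smallness condition,
  so the weighted datum is \<open>c h\<close>. Its weak derivatives are continuous with compact support, hence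
  every weighted norm is at most a constant times \<open>c\<close>. The constant is the same for all amplitudes:
  the amplitude \<open>c\<close> and the size \<open>\<epsilon>\<close> of the datum are proportional.\<close>

lemma small_data_scaled:
  assumes h: "Ck_on (M_max \<gamma>) UNIV h" and supp: "\<And>z. z \<notin> cball 0 R \<Longrightarrow> h z = 0"
    and nonneg: "\<And>z. 0 \<le> h z"
  obtains K where "K > 0"
    and "\<And>c. c \<ge> 0 \<Longrightarrow> small_data \<gamma> d0 (c * K)
      (\<lambda>(x, v). c * exp (- (2 * d0 * (1 + (norm v)\<^sup>2))) * h (x, v))"
proof -
  let ?M = "M_max \<gamma>"
  define G where "G = (\<lambda>\<alpha> \<beta>. foldl (\<lambda>g b. pd b g) h (derivative_directions \<alpha> \<beta>))"
  define w2 :: "phase \<Rightarrow> real"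
    where "w2 = (\<lambda>z. (1 + (norm (fst z))\<^sup>2) powr ((real ?M + 5) / 2))"
  define wi :: "phase \<Rightarrow> real"
    where "wi = (\<lambda>z. w2 z * (1 + (norm (snd z))\<^sup>2) powr (1 / 2))"
  have pos: "1 + (norm y)\<^sup>2 \<noteq> 0" for y :: "real^3"
    by (metis add_pos_nonneg less_irrefl zero_le_power2 zero_less_one)
  have cw2: "continuous_on UNIV w2"
    unfolding w2_def using pos by (intro continuous_intros) auto
  have cwi: "continuous_on UNIV wi"
    unfolding wi_def using pos by (intro continuous_intros cw2) auto
  have hk: "Ck_on (mi_abs \<alpha> + mi_abs \<beta>) UNIV h" if "(\<alpha>, \<beta>) \<in> multi_pairs ?M" for \<alpha> \<beta>
    using Ck_on_mono[OF h] that by (simp add: multi_pairs_def)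
  have cG: "continuous_on UNIV (G \<alpha> \<beta>)" and sG: "\<And>z. z \<notin> cball 0 R \<Longrightarrow> G \<alpha> \<beta> z = 0"
    if "(\<alpha>, \<beta>) \<in> multi_pairs ?M" for \<alpha> \<beta>
  proof -
    have "Ck_on 0 UNIV (G \<alpha> \<beta>)"
      unfolding G_def using hk[OF that] supp
      by (intro Ck_on_foldl_pd set_derivative_directions_subset) (simp_all add: length_derivative_directions)
    then show "continuous_on UNIV (G \<alpha> \<beta>)"
      by simp
    show "G \<alpha> \<beta> z = 0" if "z \<notin> cball 0 R" for z
      unfolding G_def using hk[OF \<open>(\<alpha>, \<beta>) \<in> multi_pairs ?M\<close>] supp that
      by (intro foldl_pd_zero_outside[where R = R and k = 0] set_derivative_directions_subset)
        (simp_all add: length_derivative_directions)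
  qed
  define good where "good w p K \<longleftrightarrow> 0 \<le> K \<and> (\<forall>c\<ge>0.
      L2_norm (\<lambda>z. c * (w z * (case p of (\<alpha>, \<beta>) \<Rightarrow> G \<alpha> \<beta> z))) \<le> ennreal (c * K) \<and>
      Linf_norm (\<lambda>z. c * (w z * (case p of (\<alpha>, \<beta>) \<Rightarrow> G \<alpha> \<beta> z))) \<le> ennreal (c * K))" for w p K
  have ex_good: "\<exists>K. good w p K" if "p \<in> multi_pairs ?M" "continuous_on UNIV w" for w p
  proof -
    obtain \<alpha> \<beta> where p: "p = (\<alpha>, \<beta>)"
      by (cases p)
    have "\<exists>K\<ge>0. \<forall>c\<ge>0. L2_norm (\<lambda>z. c * (w z * G \<alpha> \<beta> z)) \<le> ennreal (c * K) \<and>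
        Linf_norm (\<lambda>z. c * (w z * G \<alpha> \<beta> z)) \<le> ennreal (c * K)"
      using that p cG sG by (intro norms_cmult_le[where R = R] continuous_on_mult) auto
    then show ?thesis
      by (auto simp: good_def p)
  qed
  obtain K2 where K2: "\<And>p. p \<in> multi_pairs ?M \<Longrightarrow> good w2 p (K2 p)"
    using ex_good[OF _ cw2] by metis
  obtain Ki where Ki: "\<And>p. p \<in> multi_pairs ?M \<Longrightarrow> good wi p (Ki p)"
    using ex_good[OF _ cwi] by metis
  have sub: "p \<in> multi_pairs ?M" if "p \<in> multi_pairs (?M - 5)" for p
    using that multi_pairs_mono[of "?M - 5" ?M] by auto
  \<comment> \<open>The summand 1 makes \<open>K\<close> strictly positive, so that one can divide by it.\<close>
  define K where "K = 1 + sum K2 (multi_pairs ?M) + sum Ki (multi_pairs (?M - 5))"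
  have K2_nonneg: "0 \<le> sum K2 (multi_pairs ?M)"
    using K2 by (intro sum_nonneg) (simp add: good_def)
  have Ki_nonneg: "0 \<le> sum Ki (multi_pairs (?M - 5))"
    using Ki sub by (intro sum_nonneg) (simp add: good_def)
  show thesis
  proof (rule that)
    show "K > 0"
      using K2_nonneg Ki_nonneg by (simp add: K_def)
    fix c :: real
    assume c: "c \<ge> 0"
    let ?fin = "\<lambda>(x, v). c * exp (- (2 * d0 * (1 + (norm v)\<^sup>2))) * h (x, v)"
    let ?G = "\<lambda>\<alpha> \<beta> z. c * G \<alpha> \<beta> z"
    have eq: "(\<lambda>(x, v). exp (2 * d0 * (1 + (norm v)\<^sup>2)) * ?fin (x, v)) = (\<lambda>z. c * h z)"
      by (auto simp: fun_eq_iff exp_minus)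
    have jet: "weak_jet ?M (\<lambda>z. c * h z) ?G"
      unfolding weak_jet_def G_def
      using weak_deriv_if_Ck_on[OF hk supp] weak_deriv_cmult by blast
    have "(\<Sum>(\<alpha>, \<beta>)\<in>multi_pairs ?M.
        L2_norm (\<lambda>(x, v). (1 + (norm x)\<^sup>2) powr ((real ?M + 5) / 2) * ?G \<alpha> \<beta> (x, v)))
      = (\<Sum>p\<in>multi_pairs ?M. L2_norm (\<lambda>z. c * (w2 z * (case p of (\<alpha>, \<beta>) \<Rightarrow> G \<alpha> \<beta> z))))"
      by (intro sum.cong) (auto simp: w2_def fun_eq_iff intro!: arg_cong[of _ _ L2_norm])
    also have "\<dots> \<le> ennreal (c * sum K2 (multi_pairs ?M))"
      using K2 c by (intro sum_le_ennreal_sum) (simp_all add: good_def)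
    finally have b2: "(\<Sum>(\<alpha>, \<beta>)\<in>multi_pairs ?M.
        L2_norm (\<lambda>(x, v). (1 + (norm x)\<^sup>2) powr ((real ?M + 5) / 2) * ?G \<alpha> \<beta> (x, v)))
        \<le> ennreal (c * sum K2 (multi_pairs ?M))" .
    have "(\<Sum>(\<alpha>, \<beta>)\<in>multi_pairs (?M - 5).
        Linf_norm (\<lambda>(x, v). (1 + (norm x)\<^sup>2) powr ((real ?M + 5) / 2)
          * (1 + (norm v)\<^sup>2) powr (1 / 2) * ?G \<alpha> \<beta> (x, v)))
      = (\<Sum>p\<in>multi_pairs (?M - 5). Linf_norm (\<lambda>z. c * (wi z * (case p of (\<alpha>, \<beta>) \<Rightarrow> G \<alpha> \<beta> z))))"
      by (intro sum.cong) (auto simp: wi_def w2_def fun_eq_iff intro!: arg_cong[of _ _ Linf_norm])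
    also have "\<dots> \<le> ennreal (c * sum Ki (multi_pairs (?M - 5)))"
      using Ki sub c by (intro sum_le_ennreal_sum) (simp_all add: good_def)
    finally have bi: "(\<Sum>(\<alpha>, \<beta>)\<in>multi_pairs (?M - 5).
        Linf_norm (\<lambda>(x, v). (1 + (norm x)\<^sup>2) powr ((real ?M + 5) / 2)
          * (1 + (norm v)\<^sup>2) powr (1 / 2) * ?G \<alpha> \<beta> (x, v)))
        \<le> ennreal (c * sum Ki (multi_pairs (?M - 5)))" .
    have sum_le: "ennreal (c * sum K2 (multi_pairs ?M)) + ennreal (c * sum Ki (multi_pairs (?M - 5)))
        \<le> ennreal (c * K)"
      using c K2_nonneg Ki_nonneg
      by (simp add: K_def algebra_simps flip: ennreal_plus)
    show "small_data \<gamma> d0 (c * K) ?fin"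
      unfolding small_data_def eq
    proof (intro conjI exI[of _ ?G])
      show "\<forall>z. 0 \<le> ?fin z"
        using c nonneg by auto
    qed (use jet order_trans[OF add_mono[OF b2 bi] sum_le] in auto)
  qed
qed

section \<open>Bump functions of finite smoothness\<close>

lemma real_polynomial_function_pd:
  fixes p :: "'a::euclidean_space \<Rightarrow> real"
  assumes "real_polynomial_function p"
  shows "real_polynomial_function (pd b p)"
  using assms
proof induction
  case (linear f)
  have "pd b f = (\<lambda>_. f b)"
    using linear by (auto simp: fun_eq_iff intro: pd_eq bounded_linear_imp_has_derivative)
  then show ?case
    by (simp add: real_polynomial_function.intros(2))
next
  case (const c)
  have "pd b (\<lambda>_. c) = (\<lambda>_. 0)"
    by (auto simp: fun_eq_iff intro: pd_eq)
  then show ?case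
    by (simp add: real_polynomial_function.intros(2))
next
  case (add f g)
  have "pd b (\<lambda>x. f x + g x) = (\<lambda>x. pd b f x + pd b g x)"
  proof
    fix z
    have "((\<lambda>x. f x + g x) has_derivative
        (\<lambda>y. frechet_derivative f (at z) y + frechet_derivative g (at z) y)) (at z)"
      using add.hyps by (intro has_derivative_add)
        (simp_all add: differentiable_at_real_polynomial_function flip: frechet_derivative_works)
    then show "pd b (\<lambda>x. f x + g x) z = pd b f z + pd b g z"
      by (simp add: pd_eq) (simp add: pd_def)
  qed
  then show ?case
    using add.IH by auto
next
  case (mult f g)
  then have "pd b (\<lambda>x. f x * g x) = (\<lambda>x. f x * pd b g x + pd b f x * g x)"
    by (simp add: fun_eq_iff pd_mult differentiable_at_real_polynomial_function)
  then show ?case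
    using mult by auto
qed

lemma has_real_derivative_max_0_power:
  "((\<lambda>s. max 0 s ^ Suc (Suc k)) has_real_derivative real (Suc (Suc k)) * max 0 s ^ Suc k) (at s)"
proof (cases s "0 :: real" rule: linorder_cases)
  case less
  have "((\<lambda>_. 0) has_real_derivative 0) (at s)"
    by simp
  then have "((\<lambda>s. max 0 s ^ Suc (Suc k)) has_real_derivative 0) (at s)"
    by (rule has_field_derivative_transform_within_open[where S = "{..<0}"]) (use less in auto)
  then show ?thesis
    using less by simp
next
  case greater
  have "((\<lambda>s. s ^ Suc (Suc k)) has_real_derivative real (Suc (Suc k)) * s ^ Suc k) (at s)"
    using DERIV_pow[of "Suc (Suc k)" s UNIV] by simp
  then have "((\<lambda>s. max 0 s ^ Suc (Suc k)) has_real_derivative real (Suc (Suc k)) * s ^ Suc k) (at s)"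
    by (rule has_field_derivative_transform_within_open[where S = "{0<..}"]) (use greater in auto)
  then show ?thesis
    using greater by simp
next
  case equal
  have "((\<lambda>h. max 0 h ^ Suc k) \<longlongrightarrow> max 0 0 ^ Suc k) (at (0 :: real))"
    by (intro tendsto_intros)
  moreover have "max 0 h ^ Suc k = (max 0 (0 + h) ^ Suc (Suc k) - max 0 0 ^ Suc (Suc k)) / h"
    if "h \<noteq> 0" for h :: real
    using that by (cases "h > 0") auto
  ultimately have "((\<lambda>h. (max 0 (0 + h) ^ Suc (Suc k) - max 0 0 ^ Suc (Suc k)) / h) \<longlongrightarrow> 0) (at (0 :: real))"
    by (auto simp: eventually_at_filter elim!: Lim_transform_eventually)
  then show ?thesis
    using equal by (simp add: DERIV_def)
qed

text \<open>The class of products of a polynomial with a power of the positive part of \<open>u\<close> is closed under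
  differentiation, at the price of one power: the derivative of \<open>p u\<^sup>n\<close> is
  \<open>(\<partial>p u + n p \<partial>u) u\<^sup>n\<^sup>-\<^sup>1\<close> where \<open>u > 0\<close>. Hence a \<open>C\<^sup>k\<close> function needs exponent \<open>k + 1\<close>, and
  polynomial algebra alone produces compactly supported functions of any finite smoothness.\<close>

lemma Ck_on_polynomial_mult_max_0_power:
  fixes p u :: "'a::euclidean_space \<Rightarrow> real"
  assumes "real_polynomial_function p" and u: "real_polynomial_function u"
  shows "Ck_on k UNIV (\<lambda>z. p z * max 0 (u z) ^ Suc k)"
  using assms(1)
proof (induction k arbitrary: p)
  case 0
  have "continuous_on UNIV p" "continuous_on UNIV u"
    using 0 u by (auto intro!: continuous_on_polymonial_function simp: real_polynomial_function_eq)
  then show ?case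
    by (auto intro!: continuous_intros)
next
  case (Suc k)
  let ?n = "Suc (Suc k)"
  let ?q = "\<lambda>b z. pd b p z * u z + p z * (real ?n * pd b u z)"
  have q: "real_polynomial_function (?q b)" for b
    using Suc.prems u by (intro real_polynomial_function.intros(3) real_polynomial_function.intros(4)
      real_polynomial_function.intros(2) real_polynomial_function_pd)
  have deriv: "((\<lambda>z. p z * max 0 (u z) ^ ?n) has_derivative
      (\<lambda>y. p z * (frechet_derivative u (at z) y * (real ?n * max 0 (u z) ^ Suc k))
        + frechet_derivative p (at z) y * max 0 (u z) ^ ?n)) (at z)" for z
  proof (rule has_derivative_mult)
    show "(p has_derivative frechet_derivative p (at z)) (at z)"
      using Suc.prems by (simp add: differentiable_at_real_polynomial_function flip: frechet_derivative_works)
    have "(u has_derivative frechet_derivative u (at z)) (at z)"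
      using u by (simp add: differentiable_at_real_polynomial_function flip: frechet_derivative_works)
    moreover have "((\<lambda>s. max 0 s ^ ?n) has_derivative (\<lambda>h. h * (real ?n * max 0 (u z) ^ Suc k))) (at (u z))"
      using has_real_derivative_max_0_power[of k "u z"]
      by (simp add: has_field_derivative_def mult.commute[of _ "_ * _"] del: power_Suc of_nat_Suc)
    ultimately show "((\<lambda>z. max 0 (u z) ^ ?n) has_derivative
        (\<lambda>y. frechet_derivative u (at z) y * (real ?n * max 0 (u z) ^ Suc k))) (at z)"
      by (rule has_derivative_compose)
  qed
  have "pd b (\<lambda>z. p z * max 0 (u z) ^ ?n) = (\<lambda>z. ?q b z * max 0 (u z) ^ Suc k)" for b
  proof
    fix z
    have "max 0 (u z) ^ ?n = u z * max 0 (u z) ^ Suc k"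
      by (simp add: max_def)
    then show "pd b (\<lambda>z. p z * max 0 (u z) ^ ?n) z = ?q b z * max 0 (u z) ^ Suc k"
      unfolding pd_eq[OF deriv] by (simp add: pd_def algebra_simps del: power_Suc of_nat_Suc)
  qed
  then have "Ck_on k UNIV (pd b (\<lambda>z. p z * max 0 (u z) ^ ?n))" for b
    using Suc.IH[OF q] by simp
  then show ?case
    using deriv unfolding Ck_on.simps differentiable_on_def differentiable_def by blast
qed

lemma exists_Ck_bump:
  fixes e :: "'a::euclidean_space"
  obtains h :: "'a \<Rightarrow> real" where "Ck_on k UNIV h" and "\<And>z. 0 \<le> h z" and "h e = 1"
    and "\<And>z. norm (z - e) \<ge> 1 \<Longrightarrow> h z = 0"
proof (rule that)
  let ?u = "\<lambda>z. 1 - (norm (z - e))\<^sup>2"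
  have "?u = (\<lambda>z. 1 - (\<Sum>b\<in>Basis. (z \<bullet> b - e \<bullet> b) * (z \<bullet> b - e \<bullet> b)))"
    unfolding power2_norm_eq_inner by (subst euclidean_inner) (simp add: inner_diff_left)
  moreover have "real_polynomial_function \<dots>"
    by (intro real_polynomial_function_diff real_polynomial_function_sum real_polynomial_function.intros(4)
        real_polynomial_function.intros(2) real_polynomial_function.intros(1) bounded_linear_inner_left finite_Basis)
  ultimately have "real_polynomial_function ?u"
    by simp
  then have "Ck_on k UNIV (\<lambda>z. 1 * max 0 (?u z) ^ Suc k)"
    by (intro Ck_on_polynomial_mult_max_0_power real_polynomial_function.intros(2))
  then show "Ck_on k UNIV (\<lambda>z. max 0 (?u z) ^ Suc k)"
    by simp
  show "max 0 (?u z) ^ Suc k = 0" if "norm (z - e) \<ge> 1" for z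
  proof -
    have "1 \<le> (norm (z - e))\<^sup>2"
      using that by (simp add: power2_eq_square mult_ge1_I)
    then show ?thesis
      by (simp add: max_def)
  qed
qed simp_all

section \<open>Almost everywhere relations\<close>

lemma AE_lebesgue_imp_ex_in_open:
  fixes U :: "'a::euclidean_space set"
  assumes "AE z in lebesgue. P z" and "open U" and "U \<noteq> {}"
  shows "\<exists>z\<in>U. P z"
proof (rule ccontr)
  assume "\<not> (\<exists>z\<in>U. P z)"
  then have "U \<subseteq> {z. \<not> P z}"
    by blast
  moreover obtain N where "negligible N" "{z. \<not> P z} \<subseteq> N"
    using assms(1) unfolding eventually_ae_filter_negligible by auto
  ultimately have "negligible U"
    using negligible_subset by blast
  then show False
    using open_not_negligible assms(2,3) by blast
qed

lemma AE_le_imp_le_if_continuous: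
  fixes f g :: "'a::euclidean_space \<Rightarrow> real"
  assumes "AE z in lebesgue. f z \<le> g z" and f: "continuous_on UNIV f" and g: "continuous_on UNIV g"
  shows "f z \<le> g z"
proof (rule ccontr)
  assume "\<not> f z \<le> g z"
  then have "{z. g z < f z} \<noteq> {}"
    by (auto simp: not_le)
  moreover have "open {z. g z < f z}"
    using g f by (rule open_Collect_less)
  ultimately obtain z where "g z < f z" "f z \<le> g z"
    using AE_lebesgue_imp_ex_in_open[OF assms(1)] by blast
  then show False
    by simp
qed

text \<open>As \<open>T\<close> is onto, the exceptional set of \<open>P\<close> lies in the image under \<open>T\<close> of a null set, and a
  linear endomorphism maps null sets to null sets.\<close>

lemma AE_lebesgue_linear_vimage:
  fixes T :: "'a::euclidean_space \<Rightarrow> 'a"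
  assumes "AE z in lebesgue. P (T z)" and "linear T" and "surj T"
  shows "AE z in lebesgue. P z"
proof -
  obtain N where N: "negligible N" "{z. \<not> P (T z)} \<subseteq> N"
    using assms(1) unfolding eventually_ae_filter_negligible by auto
  have "negligible (T ` N)"
    using N(1) assms(2)
    by (intro negligible_differentiable_image_negligible linear_imp_differentiable_on) auto
  moreover have "{z. \<not> P z} \<subseteq> T ` N"
  proof
    fix y
    assume "y \<in> {z. \<not> P z}"
    moreover obtain z where "y = T z"
      using assms(3) by (metis surjD)
    ultimately show "y \<in> T ` N"
      using N(2) by auto
  qed
  ultimately show ?thesis
    unfolding eventually_ae_filter_negligible by (intro exI conjI)
qed

section \<open>Profiles of limit solutions\<close>

text \<open>Both sides are transported along free trajectories, so equality on almost all of space-time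
  gives, by Fubini, one time at which they agree almost everywhere. The shear
  \<open>(x, v) \<mapsto> (x - t v, v)\<close> brings this equality back to the profiles.\<close>

lemma limit_solution_ae_eq_imp_profile_ae_eq:
  assumes "ae_eq_spacetime (limit_solution F) M"
    and M: "\<And>t x v. t \<ge> 0 \<Longrightarrow> M t (x, v) = G (x - t *\<^sub>R v, v)"
  shows "AE z in lebesgue. F z = G z"
proof -
  have "AE p in (lborel :: (real \<times> phase) measure).
      case p of (t, z) \<Rightarrow> t \<ge> 0 \<longrightarrow> limit_solution F t z = M t z"
    using assms(1) by (simp add: ae_eq_spacetime_def AE_completion_iff)
  then have "AE p in (lborel \<Otimes>\<^sub>M lborel :: (real \<times> phase) measure).
      case p of (t, z) \<Rightarrow> t \<ge> 0 \<longrightarrow> limit_solution F t z = M t z"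
    unfolding lborel_prod .
  then have "AE t in (lborel :: real measure). AE z in (lborel :: phase measure).
      t \<ge> 0 \<longrightarrow> limit_solution F t z = M t z"
    using lborel_pair.AE_pair by fastforce
  then have "AE t in lebesgue. AE z in lebesgue. t \<ge> (0::real) \<longrightarrow> limit_solution F t z = M t z"
    by (simp add: AE_completion_iff)
  then have "\<exists>t\<in>{0<..}. AE z in lebesgue. t \<ge> 0 \<longrightarrow> limit_solution F t z = M t z"
    by (rule AE_lebesgue_imp_ex_in_open) (simp_all add: open_greaterThan)
  then obtain t where t: "t \<in> {0<..}"
    and ae: "AE z in lebesgue. t \<ge> 0 \<longrightarrow> limit_solution F t z = M t z"
    by (elim bexE) (rule that)
  define T :: "phase \<Rightarrow> phase" where "T = (\<lambda>z. (fst z - t *\<^sub>R snd z, snd z))"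
  have "linear T"
    unfolding T_def by (auto intro!: linearI simp: algebra_simps)
  moreover have "surj T"
    by (rule surjI[of _ "\<lambda>z. (fst z + t *\<^sub>R snd z, snd z)"]) (simp add: T_def)
  moreover have "AE z in lebesgue. F (T z) = G (T z)"
    using ae
  proof eventually_elim
    case (elim z)
    then show ?case
      using t M[of t "fst z" "snd z"] by (cases z) (simp add: limit_solution_def T_def)
  qed
  ultimately show ?thesis
    by (rule AE_lebesgue_linear_vimage[rotated 1])
qed

text \<open>At \<open>v = 0\<close> only the block \<open>\<alpha> I\<close> of the quadratic form survives, so the profile of a traveling
  Maxwellian is \<open>c exp (- \<alpha> |x|\<^sup>2 / 2)\<close> there, with its maximum over \<open>x\<close> at the origin when
  \<open>c \<ge> 0\<close>. The maximum with 0 in the conclusion covers \<open>c < 0\<close>, where the profile is negative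
  everywhere.\<close>

lemma traveling_maxwellian_profile:
  assumes "traveling_maxwellian M"
  obtains G :: "phase \<Rightarrow> real" where "\<And>t x v. t \<ge> 0 \<Longrightarrow> M t (x, v) = G (x - t *\<^sub>R v, v)"
    and "continuous_on UNIV G" and "\<And>x. G (x, 0) \<le> max 0 (G (0, 0))"
proof -
  obtain m \<alpha> \<sigma> \<beta> :: real and B :: "real^3^3" where \<alpha>: "\<alpha> > 0"
    and M: "\<forall>t\<ge>0. \<forall>x v. M t (x, v) =
      m * sqrt (det (mat (\<alpha> * \<sigma> - \<beta>\<^sup>2) + B ** B)) / (2 * pi) ^ 3 *
      exp (- (1 / 2) * (let w = x - t *\<^sub>R v in
        v \<bullet> (mat \<sigma> *v v + (mat \<beta> + B) *v w) + w \<bullet> ((mat \<beta> - B) *v v + mat \<alpha> *v w)))"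
    using assms unfolding traveling_maxwellian_def Let_def by blast
  define c where "c = m * sqrt (det (mat (\<alpha> * \<sigma> - \<beta>\<^sup>2) + B ** B)) / (2 * pi) ^ 3"
  define q where "q = (\<lambda>(w, v). v \<bullet> (mat \<sigma> *v v + (mat \<beta> + B) *v w)
    + w \<bullet> ((mat \<beta> - B) *v v + mat \<alpha> *v w))"
  show thesis
  proof (rule that)
    show "M t (x, v) = c * exp (- (1 / 2) * q (x - t *\<^sub>R v, v))" if "t \<ge> 0" for t x v
      using M that by (simp add: c_def q_def Let_def)
    have cont_mv: "continuous_on UNIV (\<lambda>x. A *v f x)" if "continuous_on UNIV f"
      for A :: "real^3^3" and f :: "phase \<Rightarrow> real^3"
      using that by (rule continuous_on_compose2[OF matrix_vector_mult_linear_continuous_on[of UNIV]]) auto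
    show "continuous_on UNIV (\<lambda>z. c * exp (- (1 / 2) * q z))"
      unfolding q_def case_prod_beta by (intro continuous_intros cont_mv)
    have "mat \<alpha> *v x = \<alpha> *\<^sub>R x" for x :: "real^3"
      by (simp add: vec_eq_iff matrix_vector_mult_def mat_def if_distrib[of "\<lambda>a. a * _"] cong: if_cong)
    then have "q (x, 0) \<ge> 0" for x
      using \<alpha> by (simp add: q_def)
    then have "exp (- (1 / 2) * q (x, 0)) \<le> 1" for x
      by simp
    moreover have "q (0, 0) = 0"
      by (simp add: q_def)
    ultimately show "c * exp (- (1 / 2) * q (x, 0)) \<le> max 0 (c * exp (- (1 / 2) * q (0, 0)))" for x
      by (cases "c \<ge> 0") (auto simp: max_def mult_left_le mult_le_0_iff not_le)
  qed
qed

section \<open>Comparison of the profile with the initial datum\<close>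

text \<open>This is the decay estimate at time \<open>t = 0\<close>, where \<open>f\<^sup>\<sharp>\<close> is the initial datum and the
  polynomial weights are at least 1.\<close>

lemma profile_close_to_initial_datum:
  assumes f: "landau_solution \<phi> \<gamma> fin f" and F: "asymptotic_profile \<gamma> C \<epsilon> f F"
  shows "AE z in lebesgue. \<bar>fin z - F z\<bar> \<le> \<bar>C 0\<bar> * \<epsilon> powr (3 / 2)"
proof -
  let ?d = "\<lambda>(x, v). (1 + (norm v)\<^sup>2) powr (real 0 / 2)
    * (1 + (norm x)\<^sup>2) powr ((real (M_max \<gamma>) + 4) / 2) * (sharp f 0 (x, v) - F (x, v))"
  have "ennreal ((1 + 0) powr (min 1 (2 + \<gamma>))) * Linf_norm ?d \<le> ennreal (C 0 * \<epsilon> powr (3 / 2))"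
  proof (rule order_trans)
    show "ennreal ((1 + 0) powr (min 1 (2 + \<gamma>))) * Linf_norm ?d
      \<le> (SUP t\<in>{0..}. ennreal ((1 + t) powr (min 1 (2 + \<gamma>))) *
             Linf_norm (\<lambda>(x, v). (1 + (norm v)\<^sup>2) powr (real 0 / 2)
                * (1 + (norm x)\<^sup>2) powr ((real (M_max \<gamma>) + 4) / 2)
                * (sharp f t (x, v) - F (x, v))))"
      by (rule SUP_upper) simp
  qed (use F in \<open>unfold asymptotic_profile_def, blast\<close>)
  then have Linf: "Linf_norm ?d \<le> ennreal (C 0 * \<epsilon> powr (3 / 2))"
    by simp
  have "AE z in lebesgue. ennreal \<bar>?d z\<bar> \<le> Linf_norm ?d"
    unfolding Linf_norm_def by (rule esssup_AE)
  moreover have "AE z in lebesgue. f 0 z = fin z"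
    using f by (simp add: landau_solution_def)
  ultimately show ?thesis
  proof eventually_elim
    case (elim z)
    obtain x v where z: "z = (x, v)"
      by (cases z)
    have "ennreal \<bar>?d z\<bar> \<le> ennreal (\<bar>C 0\<bar> * \<epsilon> powr (3 / 2))"
      using elim(1) Linf by (rule order_trans[OF order_trans]) (simp add: ennreal_leI mult_right_mono)
    then have "\<bar>?d z\<bar> \<le> \<bar>C 0\<bar> * \<epsilon> powr (3 / 2)"
      by (simp add: ennreal_le_iff)
    moreover have "\<bar>?d z\<bar> = (1 + (norm x)\<^sup>2) powr ((real (M_max \<gamma>) + 4) / 2) * \<bar>fin z - F z\<bar>"
      using elim(2) add_pos_nonneg[OF zero_less_one zero_le_power2[of "norm v"]]
      by (simp add: z sharp_def abs_mult)
    moreover have "(1 + (norm x)\<^sup>2) powr ((real (M_max \<gamma>) + 4) / 2) \<ge> 1"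
      by (intro ge_one_powr_ge_zero) auto
    ultimately show ?case
      using mult_right_mono[of 1 _ "\<bar>fin z - F z\<bar>"] by fastforce
  qed
qed

text \<open>A continuous profile whose value at \<open>e\<close> does not exceed its value at the origin (or 0) forces the
  datum, which vanishes at the origin, to be almost as small at \<open>e\<close>: each of the two points costs
  one error \<open>|C 0| \<epsilon> powr (3 / 2)\<close>. Continuity turns the estimate, known almost everywhere, into
  one at these two points.\<close>

lemma initial_datum_le_if_profile_peaks_at_origin:
  assumes f: "landau_solution \<phi> \<gamma> fin f" and F: "asymptotic_profile \<gamma> C \<epsilon> f F"
    and fin: "continuous_on UNIV fin" and G: "continuous_on UNIV G" "AE z in lebesgue. F z = G z"
    and peak: "G e \<le> max 0 (G 0)" and "fin 0 = 0"
  shows "fin e \<le> 2 * \<bar>C 0\<bar> * \<epsilon> powr (3 / 2)"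
proof -
  let ?\<delta> = "\<bar>C 0\<bar> * \<epsilon> powr (3 / 2)"
  have "AE z in lebesgue. \<bar>fin z - G z\<bar> \<le> ?\<delta>"
    using profile_close_to_initial_datum[OF f F] G(2) by eventually_elim simp
  then have "\<bar>fin z - G z\<bar> \<le> ?\<delta>" for z
    by (rule AE_le_imp_le_if_continuous) (intro continuous_intros fin G(1))+
  from this[of e] this[of 0] show ?thesis
    using peak \<open>fin 0 = 0\<close> by (simp add: max_def split: if_splits)
qed

lemma powr_three_halves_small:
  fixes a b \<epsilon>0 :: real
  assumes "a > 0" and "b \<ge> 0" and "\<epsilon>0 > 0"
  obtains \<epsilon> where "0 < \<epsilon>" and "\<epsilon> \<le> \<epsilon>0" and "b * \<epsilon> powr (3 / 2) < a * \<epsilon>"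
proof -
  \<comment> \<open>The summand 1 in the denominator admits \<open>b = 0\<close>.\<close>
  define r where "r = a / (b + 1)"
  have r: "r > 0" "b * r < a"
    using assms by (simp_all add: r_def field_simps)
  define \<epsilon> where "\<epsilon> = min \<epsilon>0 (r\<^sup>2)"
  have \<epsilon>: "0 < \<epsilon>" "\<epsilon> \<le> \<epsilon>0"
    using assms r by (simp_all add: \<epsilon>_def)
  have "sqrt \<epsilon> \<le> r"
    using r by (intro real_le_lsqrt) (simp_all add: \<epsilon>_def)
  have "\<epsilon> powr (3 / 2) = \<epsilon> powr (1 + 1 / 2)"
    by simp
  also have "\<dots> = \<epsilon> * sqrt \<epsilon>"
    using \<epsilon> unfolding powr_add by (simp add: powr_half_sqrt)
  finally have "b * \<epsilon> powr (3 / 2) = (b * sqrt \<epsilon>) * \<epsilon>"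
    by simp
  also have "\<dots> < a * \<epsilon>"
  proof (rule mult_strict_right_mono)
    show "b * sqrt \<epsilon> < a"
      using mult_left_mono[OF \<open>sqrt \<epsilon> \<le> r\<close> assms(2)] r(2) by simp
  qed (use \<epsilon> in simp)
  finally show ?thesis
    using that \<epsilon> by blast
qed

section \<open>A limit that is neither zero nor Maxwellian\<close>

theorem theorem1p6:
  fixes \<phi> :: "real^3 \<Rightarrow> real" and \<gamma> d0 \<epsilon>0 :: real and C :: "nat \<Rightarrow> real"
  assumes "cutoff \<phi>"
    and "-2 < \<gamma>" and "\<gamma> < 0" and "d0 > 0" and "\<epsilon>0 > 0"
    and "global_existence \<phi> \<gamma> d0 \<epsilon>0"
    and "asymptotic_stability \<phi> \<gamma> d0 \<epsilon>0 C"
  shows "\<exists>fin. \<exists>\<epsilon>\<in>{0..\<epsilon>0}. small_data \<gamma> d0 \<epsilon> fin \<and>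
    (\<exists>f F. smooth_landau_solution \<phi> \<gamma> fin f \<and> asymptotic_profile \<gamma> C \<epsilon> f F) \<and>
    (\<forall>f F. smooth_landau_solution \<phi> \<gamma> fin f \<longrightarrow> asymptotic_profile \<gamma> C \<epsilon> f F \<longrightarrow>
       \<not> ae_eq_spacetime (limit_solution F) (\<lambda>t z. 0) \<and>
       \<not> (\<exists>M. traveling_maxwellian M \<and> ae_eq_spacetime (limit_solution F) M))"
proof -
  define e :: phase where "e = (axis 1 1, 0)"
  have norm_e: "norm e = 1"
    by (simp add: e_def norm_axis_1)
  obtain h :: "phase \<Rightarrow> real" where h: "Ck_on (M_max \<gamma>) UNIV h" "\<And>z. 0 \<le> h z" "h e = 1"
    and h0: "\<And>z. norm (z - e) \<ge> 1 \<Longrightarrow> h z = 0"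
    using exists_Ck_bump[of "M_max \<gamma>" e] by blast
  have "h 0 = 0"
    by (rule h0) (simp add: norm_e)
  have supp: "h z = 0" if "z \<notin> cball 0 2" for z
    by (rule h0) (use that norm_triangle_ineq2[of z e] norm_e in simp)
  obtain K where "K > 0" and small: "\<And>c. c \<ge> 0 \<Longrightarrow> small_data \<gamma> d0 (c * K)
      (\<lambda>(x, v). c * exp (- (2 * d0 * (1 + (norm v)\<^sup>2))) * h (x, v))"
    using small_data_scaled[OF h(1) supp h(2)] by blast
  \<comment> \<open>A datum of size \<open>\<epsilon>\<close> has amplitude \<open>\<epsilon> / K\<close>, hence takes the value
    \<open>exp (- (2 * d0)) / K * \<epsilon>\<close> at \<open>e\<close>.\<close>
  have "exp (- (2 * d0)) / K > 0"
    using \<open>K > 0\<close> by simp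
  then obtain \<epsilon> where \<epsilon>: "0 < \<epsilon>" "\<epsilon> \<le> \<epsilon>0"
    and gap: "2 * \<bar>C 0\<bar> * \<epsilon> powr (3 / 2) < exp (- (2 * d0)) / K * \<epsilon>"
    using powr_three_halves_small[of "exp (- (2 * d0)) / K" "2 * \<bar>C 0\<bar>" \<epsilon>0] assms(5) by auto
  define fin where "fin = (\<lambda>(x, v). \<epsilon> / K * exp (- (2 * d0 * (1 + (norm v)\<^sup>2))) * h (x, v))"
  have fin_small: "small_data \<gamma> d0 \<epsilon> fin"
    using small[of "\<epsilon> / K"] \<epsilon> \<open>K > 0\<close> by (simp add: fin_def)
  have fin_eq: "fin = (\<lambda>z. \<epsilon> / K * exp (- (2 * d0 * (1 + (norm (snd z))\<^sup>2))) * h z)"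
    by (auto simp: fin_def fun_eq_iff)
  have fin_cont: "continuous_on UNIV fin"
    unfolding fin_eq by (intro continuous_intros Ck_on_imp_continuous_on[OF h(1)])
  have fin_0: "fin 0 = 0"
    by (simp add: fin_eq \<open>h 0 = 0\<close>)
  have fin_e: "fin e = exp (- (2 * d0)) / K * \<epsilon>"
    using h(3) by (simp add: fin_eq e_def)
  have not_peaked: False
    if f: "smooth_landau_solution \<phi> \<gamma> fin f" and F: "asymptotic_profile \<gamma> C \<epsilon> f F"
      and lim: "ae_eq_spacetime (limit_solution F) M"
      and G: "\<And>t x v. t \<ge> 0 \<Longrightarrow> M t (x, v) = G (x - t *\<^sub>R v, v)" "continuous_on UNIV G"
      and peak: "G e \<le> max 0 (G 0)"
    for f F M G
  proof -
    have ae: "AE z in lebesgue. F z = G z"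
      using lim G(1) by (rule limit_solution_ae_eq_imp_profile_ae_eq)
    have "landau_solution \<phi> \<gamma> fin f"
      using f by (simp add: smooth_landau_solution_def)
    then have "fin e \<le> 2 * \<bar>C 0\<bar> * \<epsilon> powr (3 / 2)"
      using F fin_cont G(2) ae peak fin_0 by (rule initial_datum_le_if_profile_peaks_at_origin)
    then show False
      using gap by (simp add: fin_e)
  qed
  have \<epsilon>_in: "\<epsilon> \<in> {0..\<epsilon>0}"
    using \<epsilon> by simp
  show ?thesis
  proof (intro exI[of _ fin] bexI[of _ \<epsilon>] conjI allI impI)
    obtain f where f: "smooth_landau_solution \<phi> \<gamma> fin f"
      using assms(6) \<epsilon>_in fin_small unfolding global_existence_def by blast
    moreover obtain F where "asymptotic_profile \<gamma> C \<epsilon> f F"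
      using assms(7) \<epsilon>_in fin_small f unfolding asymptotic_stability_def by blast
    ultimately show "\<exists>f F. smooth_landau_solution \<phi> \<gamma> fin f \<and> asymptotic_profile \<gamma> C \<epsilon> f F"
      by blast
  next
    fix f F
    assume f: "smooth_landau_solution \<phi> \<gamma> fin f" and F: "asymptotic_profile \<gamma> C \<epsilon> f F"
    show "\<not> ae_eq_spacetime (limit_solution F) (\<lambda>t z. 0)"
      using not_peaked[OF f F, of "\<lambda>t z. 0" "\<lambda>z. 0"] by auto
    show "\<not> (\<exists>M. traveling_maxwellian M \<and> ae_eq_spacetime (limit_solution F) M)"
    proof
      assume "\<exists>M. traveling_maxwellian M \<and> ae_eq_spacetime (limit_solution F) M"
      then obtain M where M: "traveling_maxwellian M" and lim: "ae_eq_spacetime (limit_solution F) M"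
        by blast
      obtain G where G: "\<And>t x v. t \<ge> 0 \<Longrightarrow> M t (x, v) = G (x - t *\<^sub>R v, v)" "continuous_on UNIV G"
        and peak: "\<And>x. G (x, 0) \<le> max 0 (G (0, 0))"
        using traveling_maxwellian_profile[OF M] by blast
      have "G e \<le> max 0 (G 0)"
        using peak[of "axis 1 1"] by (simp add: e_def zero_prod_def)
      with f F lim G show False
        by (rule not_peaked)
    qed
  qed (use \<epsilon>_in fin_small in simp_all)
qed

end
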